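(* Let $F : I \to \mathbb{R}$, where $I := (0,\rho)$ and $0 < \rho \leq \infty$. Fix $u_0 \in (0,1)$ and an integer $N \geq 3$, and let $\mathbf{u} := (1, u_0, \dots, u_0^{N-1})^T$. Suppose $F[-]$ preserves positivity on $\mathcal{P}_2(I)$ (that is, $F[A] \in \mathcal{P}_2(\mathbb{R})$ for all $A \in \mathcal{P}_2(I)$), and $F[A] \in \mathcal{P}_N(\mathbb{R})$ for every matrix $A$ in the family of Hankel matrices \[ \{ A = a \mathbf{1}_{N \times N} + b \mathbf{u}\mathbf{u}^T :\ a \in [0,\rho), \ b \in [0,\rho-a), \ 0 < a+b < \rho \}. \] Then $F \in C^{N-3}(I)$, with \[ F^{(k)}(x) \geq 0 \qquad \text{for all } x \in I \quad (0 \leq k \leq N-3), \] and $F^{(N-3)}$ is a convex non-decreasing function on $I$. If, further, $F \in C^{N-1}(I)$, then $F^{(k)}(x) \geq 0$ for all $x \in I$ and $0 \leq k \leq N-1$. Finally, if $F$ is assumed to be continuous on $I$, then the assumption that $F[-]$ preserves positivity on $\mathcal{P}_2(I)$ is not necessary.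
   Context: For $I \subset \mathbb{R}$ and $N \geq 1$, $\mathcal{P}_N(I)$ is the set of real symmetric positive semidefinite $N \times N$ matrices with entries in $I$. For a matrix $A = (a_{ij})$ with entries in the domain of $F$, $F[A] := (F(a_{ij}))$. $\mathbf{1}_{N \times N}$ is the $N \times N$ matrix with all entries equal to $1$. *)

theory Defs
  imports "HOL-Analysis.Analysis" "Jordan_Normal_Form.Matrix"
begin

no_notation inner (infix \<open>\<bullet>\<close> 70)

definition psd_mats :: "nat \<Rightarrow> real set \<Rightarrow> real mat set" where
  "psd_mats N I = {A \<in> carrier_mat N N. elements_mat A \<subseteq> I \<and> transpose_mat A = A \<and>
     (\<forall>v \<in> carrier_vec N. 0 \<le> v \<bullet> (A *\<^sub>v v))}"

definition ones_mat :: "nat \<Rightarrow> real mat" where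
  "ones_mat N = mat N N (\<lambda>_. 1)"

definition outer_mat :: "real Matrix.vec \<Rightarrow> real mat" where
  "outer_mat v = mat_of_cols (dim_vec v) [v] * mat_of_rows (dim_vec v) [v]"

definition geom_vec :: "nat \<Rightarrow> real \<Rightarrow> real Matrix.vec" where
  "geom_vec N u0 = Matrix.vec N (\<lambda>i. u0 ^ i)"

definition ival :: "ereal \<Rightarrow> real set" where
  "ival \<rho> = {x. 0 < x \<and> ereal x < \<rho>}"

text \<open>For \<open>\<rho> = \<infinity>\<close> the conditions on \<open>a\<close> and \<open>b\<close> reduce to \<open>0 \<le> a\<close>, \<open>0 \<le> b\<close>, \<open>0 < a + b\<close>, as
  \<open>\<infinity> - ereal a = \<infinity>\<close>.\<close>

definition hankel_family :: "ereal \<Rightarrow> real \<Rightarrow> nat \<Rightarrow> real mat set" where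
  "hankel_family \<rho> u0 N =
     {a \<cdot>\<^sub>m ones_mat N + b \<cdot>\<^sub>m outer_mat (geom_vec N u0) | a b.
        0 \<le> a \<and> ereal a < \<rho> \<and> 0 \<le> b \<and> ereal b < \<rho> - ereal a \<and>
        0 < a + b \<and> ereal (a + b) < \<rho>}"

lemma hankel_entry:
  assumes "i < N" "j < N"
  shows "(a \<cdot>\<^sub>m ones_mat N + b \<cdot>\<^sub>m outer_mat (geom_vec N u0)) $$ (i, j) = a + b * u0 ^ (i + j)"
  using assms
  by (simp add: ones_mat_def outer_mat_def geom_vec_def scalar_prod_def mat_of_rows_def
      mat_of_cols_def power_add)

definition nth_deriv :: "nat \<Rightarrow> (real \<Rightarrow> real) \<Rightarrow> real \<Rightarrow> real" where
  "nth_deriv k F = (deriv ^^ k) F"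

text \<open>\<open>C\<^sup>k\<close> on an \<^emph>\<open>open\<close> set \<open>S\<close>: since \<^const>\<open>deriv\<close> is the two-sided derivative and is
  determined at a point of \<open>S\<close> by the values of \<open>F\<close> on \<open>S\<close>, the values of \<open>F\<close> off \<open>S\<close> are
  irrelevant. Differentiability has to be required separately, as \<^const>\<open>deriv\<close> is total.\<close>

definition Ck_on :: "nat \<Rightarrow> (real \<Rightarrow> real) \<Rightarrow> real set \<Rightarrow> bool" where
  "Ck_on k F S \<longleftrightarrow>
     (\<forall>j<k. \<forall>x\<in>S. nth_deriv j F field_differentiable at x) \<and> continuous_on S (nth_deriv k F)"

end

theory Submission
  imports Defs "HOL-Computational_Algebra.Polynomial"
begin

text \<open>
  Suppose first that \<open>F\<close> is smooth. Testing positivity of the matrix with entries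
  \<open>F (a + t u\<^sup>p\<^sup>+\<^sup>q)\<close> against a vector \<open>v\<close> and expanding in \<open>t\<close> gives the series
  \<open>\<Sum>i. F\<^sup>(\<^sup>i\<^sup>) (a) / i! * t\<^sup>i * (\<Sum>p. v\<^sub>p u\<^sup>i\<^sup>p)\<^sup>2\<close>, because the \<open>i\<close>-th entrywise power of a rank one
  matrix has rank one. The nodes \<open>1, u, u\<^sup>2, \<dots>\<close> are distinct, so for each \<open>k < N\<close> some \<open>v\<close> kills all
  terms with \<open>i < k\<close> but not the term with \<open>i = k\<close>; letting \<open>t\<close> tend to \<open>0\<close> yields
  \<open>F\<^sup>(\<^sup>k\<^sup>) (a) \<ge> 0\<close> (\<open>hankel_psd_imp_deriv_nonneg\<close>).

  If \<open>F\<close> is merely continuous, replace it by the averages \<open>x \<mapsto> (1/d) * \<integral> F\<close> over \<open>[x, x + d]\<close>, iterated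
  \<open>N - 1\<close> times (\<open>smoothing\<close>). Translating the argument of \<open>F\<close> only moves the parameter \<open>a\<close>, so
  averaging preserves the positivity hypothesis on a slightly shorter interval, and each average gains
  one derivative. Hence the averages have nonnegative derivatives up to order \<open>N - 1\<close>, and they
  converge to \<open>F\<close> as \<open>d\<close> tends to \<open>0\<close>.

  Nonnegative derivatives bound themselves: as all of them but the last are nondecreasing, the second derivative at
  a point is controlled by the value of the function slightly to the right. Three such derivatives
  therefore let pointwise convergence pass from a sequence to its derivatives, and the limit
  is differentiable with the limit derivative (\<open>deriv_of_limit\<close>). Starting from order \<open>N - 1\<close> this
  can be repeated \<open>N - 3\<close> times; at the last order two nonnegative derivatives remain, which in the
  limit survive as monotonicity and convexity (\<open>limit_monotone_to_order\<close>).

  Finally, preserving positivity of two-by-two matrices makes \<open>F\<close> nonnegative, nondecreasing and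
  multiplicatively mid-convex, and a jump would contradict mid-convexity
  (\<open>continuous_on_if_psd2_ineq\<close>). This reduces the first case of the theorem to the second.
\<close>

section \<open>Quadratic forms of Hankel matrices and Taylor expansion\<close>

text \<open>The quadratic forms of the matrices \<open>f[a 1 + b u u\<^sup>T]\<close>. Strict positivity of \<open>a\<close> and \<open>b\<close>
  keeps all arguments of \<open>f\<close> strictly between \<open>a\<close> and \<open>R\<close> when \<open>0 < u < 1\<close>. Translating
  \<open>f\<close> by \<open>d\<close> shifts \<open>a\<close>, so the condition passes to \<open>x \<mapsto> f (x + d)\<close> with \<open>R - d\<close> in place of \<open>R\<close>.\<close>

definition hankel_psd :: "nat \<Rightarrow> real \<Rightarrow> real \<Rightarrow> (real \<Rightarrow> real) \<Rightarrow> bool" where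
  "hankel_psd N u R f \<longleftrightarrow> (\<forall>v a b. 0 < a \<and> 0 < b \<and> a + b < R \<longrightarrow>
     0 \<le> (\<Sum>p<N. \<Sum>q<N. v p * v q * f (a + b * u ^ (p + q))))"

lemma hankel_psdD:
  assumes "hankel_psd N u R f" "0 < a" "0 < b" "a + b < R"
  shows "0 \<le> (\<Sum>p<N. \<Sum>q<N. v p * v q * f (a + b * u ^ (p + q)))"
  using assms unfolding hankel_psd_def by blast

lemma hankel_arg_in_interval:
  fixes u :: real
  assumes "0 < u" "u < 1" "0 < b"
  shows "a < a + b * u ^ m" "a + b * u ^ m \<le> a + b"
proof -
  have "u ^ m \<le> 1" using assms by (simp add: power_le_one)
  then show "a + b * u ^ m \<le> a + b" using assms by (simp add: mult_left_le)
  show "a < a + b * u ^ m" using assms by simp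
qed

text \<open>The vectors \<open>(u\<^sup>i\<^sup>p)\<^sub>p\<close> for \<open>i \<le> n\<close> are columns of a Vandermonde matrix with distinct nodes \<open>u\<^sup>i\<close>. Pairing \<open>v\<close>
  with them evaluates the polynomial with coefficients \<open>v\<close> at the nodes, so the coefficients of
  the polynomial with roots \<open>1, u, \<dots>, u\<^sup>n\<^sup>-\<^sup>1\<close> separate the last node from the others.\<close>

lemma vandermonde_annihilator:
  fixes u :: real
  assumes u: "0 < u" "u < 1" and n: "n < N"
  obtains v :: "nat \<Rightarrow> real"
  where "\<And>i. i < n \<Longrightarrow> (\<Sum>p<N. v p * (u ^ i) ^ p) = 0"
    and "(\<Sum>p<N. v p * (u ^ n) ^ p) \<noteq> 0"
proof -
  define P where "P = (\<Prod>i<n. [:- (u ^ i), 1:])"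
  have "degree P \<le> (\<Sum>i<n. 1)"
    unfolding P_def by (rule order_trans[OF degree_prod_sum_le]) (auto intro: sum_mono)
  then have deg: "degree P < N" using n by simp
  have eval: "(\<Sum>p<N. coeff P p * z ^ p) = poly P z" for z
    unfolding poly_altdef
    by (rule sum.mono_neutral_right) (use deg in \<open>auto simp: coeff_eq_0\<close>)
  have P: "poly P z = (\<Prod>i<n. z - u ^ i)" for z
    by (simp add: P_def poly_prod)
  show ?thesis
  proof (rule that[of "coeff P"])
    show "(\<Sum>p<N. coeff P p * (u ^ i) ^ p) = 0" if "i < n" for i
      unfolding eval P using that by auto
    have "u ^ n \<noteq> u ^ i" if "i < n" for i
      using power_strict_decreasing[OF that u] by simp
    then show "(\<Sum>p<N. coeff P p * (u ^ n) ^ p) \<noteq> 0"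
      unfolding eval P by auto
  qed
qed

lemma hankel_form_power:
  fixes u t :: real
  shows "(\<Sum>p<N. \<Sum>q<N. v p * v q * (t * u ^ (p + q)) ^ i) = t ^ i * (\<Sum>p<N. v p * (u ^ i) ^ p)\<^sup>2"
  unfolding power2_eq_square sum_product
  unfolding sum_distrib_left
  by (intro sum.cong refl)
     (simp add: power_mult_distrib power_add power_mult[symmetric] mult.commute[of i])

lemma taylor_forward:
  fixes D :: "nat \<Rightarrow> real \<Rightarrow> real"
  assumes D: "\<And>k y. k < n \<Longrightarrow> x \<le> y \<Longrightarrow> y \<le> x + s \<Longrightarrow> (D k has_real_derivative D (Suc k) y) (at y)"
    and s: "0 < s"
  shows "\<exists>\<xi>. x < \<xi> \<and> \<xi> \<le> x + s \<and>
           D 0 (x + s) = (\<Sum>m<n. D m x / fact m * s ^ m) + D n \<xi> / fact n * s ^ n"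
proof (cases "n = 0")
  case True
  then show ?thesis using s by (intro exI[of _ "x + s"]) auto
next
  case False
  then show ?thesis
    using Taylor[of n D "D 0" x "x + s" x "x + s"] D s by fastforce
qed

text \<open>Horn's argument. Were \<open>D n x\<close> negative, the order \<open>n\<close> term of the expansion in \<open>t\<close> would be
  \<open>- c * t ^ n / n!\<close> with \<open>c > 0\<close> while all lower terms vanish. The intermediate points in the Taylor
  remainders depend on \<open>p\<close> and \<open>q\<close>, and the products \<open>v p * v q\<close> have both signs, so the remainders
  cannot be estimated by their sign alone: continuity of \<open>D n\<close> makes their total effect smaller than \<open>c\<close>.\<close>

lemma hankel_psd_imp_deriv_nonneg:
  fixes D :: "nat \<Rightarrow> real \<Rightarrow> real"
  assumes u: "0 < u" "u < 1" and n: "n < N" and psd: "hankel_psd N u R (D 0)"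
    and x: "0 < x" "x < R"
    and D: "\<And>k y. k < n \<Longrightarrow> 0 < y \<Longrightarrow> y < R \<Longrightarrow> (D k has_real_derivative D (Suc k) y) (at y)"
    and cont: "isCont (D n) x"
  shows "0 \<le> D n x"
proof (rule ccontr)
  assume "\<not> 0 \<le> D n x"
  then have neg: "D n x < 0" by simp
  obtain v where v0: "\<And>i. i < n \<Longrightarrow> (\<Sum>p<N. v p * (u ^ i) ^ p) = 0"
    and vn: "(\<Sum>p<N. v p * (u ^ n) ^ p) \<noteq> 0"
    using vandermonde_annihilator[OF u n] by metis
  define P where "P = (\<Sum>p<N. v p * (u ^ n) ^ p)"
  define S where "S = (\<Sum>p<N. \<bar>v p\<bar>)"
  define c where "c = - D n x * P\<^sup>2"
  \<comment> \<open>The remainders contribute at most S^2 times the oscillation of D n, which this choice keeps below c.\<close>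
  define \<epsilon> where "\<epsilon> = c / (S\<^sup>2 + 1)"
  have c: "0 < c" using neg vn by (simp add: c_def P_def mult_neg_pos)
  have S1: "0 < S\<^sup>2 + 1" by (simp add: add_nonneg_pos)
  have \<epsilon>: "0 < \<epsilon>" using c S1 by (simp add: \<epsilon>_def)
  have \<epsilon>S: "S\<^sup>2 * \<epsilon> < c" using c S1 by (simp add: \<epsilon>_def field_simps)
  obtain \<delta> where \<delta>: "0 < \<delta>" "\<And>y. \<bar>y - x\<bar> < \<delta> \<Longrightarrow> \<bar>D n y - D n x\<bar> < \<epsilon>"
    using cont \<epsilon> unfolding continuous_at_eps_delta by (auto simp: dist_real_def)
  define t where "t = min (\<delta> / 2) ((R - x) / 2)"
  have t: "0 < t" "t < \<delta>" "x + t < R" using \<delta> x by (auto simp: t_def min_def field_simps)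
  let ?w = "\<lambda>p q. t * u ^ (p + q)"
  have w: "0 < ?w p q" "?w p q \<le> t" for p q
    using hankel_arg_in_interval[OF u t(1), of 0 "p + q"] by auto
  define expansion where "expansion p q z \<longleftrightarrow> x < z \<and> z \<le> x + ?w p q \<and>
      D 0 (x + ?w p q) = (\<Sum>m<n. D m x / fact m * ?w p q ^ m) + D n z / fact n * ?w p q ^ n" for p q z
  have "\<exists>z. expansion p q z" for p q
    unfolding expansion_def
  proof (rule taylor_forward)
    fix k y assume "k < n" "x \<le> y" "y \<le> x + ?w p q"
    then show "(D k has_real_derivative D (Suc k) y) (at y)"
      using D x t w[of p q] by auto
  qed (rule w)
  then obtain \<xi> where \<xi>_expansion: "\<And>p q. expansion p q (\<xi> p q)" by metis
  then have \<xi>: "x < \<xi> p q" "\<xi> p q \<le> x + ?w p q"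
    and tay: "D 0 (x + ?w p q) =
        (\<Sum>m<n. D m x / fact m * ?w p q ^ m) + D n (\<xi> p q) / fact n * ?w p q ^ n" for p q
    unfolding expansion_def by blast+
  have err: "\<bar>D n (\<xi> p q) - D n x\<bar> < \<epsilon>" for p q
    using \<xi>[of p q] w[of p q] t by (intro \<delta>(2)) linarith
  have split: "v p * v q * D 0 (x + ?w p q) =
      (\<Sum>m<n. D m x / fact m * (v p * v q * ?w p q ^ m))
      + D n x / fact n * (v p * v q * ?w p q ^ n)
      + v p * v q * (D n (\<xi> p q) - D n x) / fact n * ?w p q ^ n" for p q
    unfolding tay by (simp add: algebra_simps sum_distrib_left diff_divide_distrib)
  have low: "(\<Sum>p<N. \<Sum>q<N. \<Sum>m<n. D m x / fact m * (v p * v q * ?w p q ^ m)) = 0"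
  proof -
    have "(\<Sum>p<N. \<Sum>q<N. \<Sum>m<n. D m x / fact m * (v p * v q * ?w p q ^ m))
        = (\<Sum>p<N. \<Sum>m<n. \<Sum>q<N. D m x / fact m * (v p * v q * ?w p q ^ m))"
      by (intro sum.cong refl sum.swap)
    also have "\<dots> = (\<Sum>m<n. \<Sum>p<N. \<Sum>q<N. D m x / fact m * (v p * v q * ?w p q ^ m))"
      by (rule sum.swap)
    also have "\<dots> = (\<Sum>m<n. D m x / fact m * (\<Sum>p<N. \<Sum>q<N. v p * v q * ?w p q ^ m))"
      by (simp add: sum_distrib_left)
    also have "\<dots> = 0"
      unfolding hankel_form_power by (intro sum.neutral ballI) (simp add: v0)
    finally show ?thesis .
  qed
  have main: "(\<Sum>p<N. \<Sum>q<N. D n x / fact n * (v p * v q * ?w p q ^ n)) = - c * t ^ n / fact n"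
    unfolding sum_distrib_left[symmetric] hankel_form_power
    by (simp add: c_def P_def)
  have rest: "(\<Sum>p<N. \<Sum>q<N. v p * v q * (D n (\<xi> p q) - D n x) / fact n * ?w p q ^ n)
      \<le> S\<^sup>2 * \<epsilon> * t ^ n / fact n"
  proof -
    have "(\<Sum>p<N. \<Sum>q<N. v p * v q * (D n (\<xi> p q) - D n x) / fact n * ?w p q ^ n)
        \<le> (\<Sum>p<N. \<Sum>q<N. \<bar>v p\<bar> * \<bar>v q\<bar> * \<epsilon> / fact n * t ^ n)"
    proof (intro sum_mono)
      fix p q
      have "v p * v q * (D n (\<xi> p q) - D n x) / fact n * ?w p q ^ n
          \<le> \<bar>v p * v q * (D n (\<xi> p q) - D n x) / fact n * ?w p q ^ n\<bar>" by (rule abs_ge_self)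
      also have "\<dots> = \<bar>v p\<bar> * \<bar>v q\<bar> * \<bar>D n (\<xi> p q) - D n x\<bar> / fact n * ?w p q ^ n"
        using w(1)[of p q] by (simp add: abs_mult)
      also have "\<dots> \<le> \<bar>v p\<bar> * \<bar>v q\<bar> * \<epsilon> / fact n * t ^ n"
        using err[of p q] w[of p q]
        by (intro mult_mono divide_right_mono power_mono mult_left_mono) auto
      finally show "v p * v q * (D n (\<xi> p q) - D n x) / fact n * ?w p q ^ n
          \<le> \<bar>v p\<bar> * \<bar>v q\<bar> * \<epsilon> / fact n * t ^ n" .
    qed
    also have "\<dots> = S\<^sup>2 * \<epsilon> * t ^ n / fact n"
      unfolding S_def power2_eq_square sum_product by (simp add: sum_distrib_right sum_divide_distrib)
    finally show ?thesis .
  qed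
  have "0 \<le> (\<Sum>p<N. \<Sum>q<N. v p * v q * D 0 (x + ?w p q))"
    by (rule hankel_psdD[OF psd x(1) t(1,3)])
  also have "\<dots> \<le> - c * t ^ n / fact n + S\<^sup>2 * \<epsilon> * t ^ n / fact n"
    using low main rest unfolding split sum.distrib by linarith
  also have "\<dots> = (S\<^sup>2 * \<epsilon> - c) * (t ^ n / fact n)" by (simp add: algebra_simps diff_divide_distrib)
  also have "\<dots> < 0" using \<epsilon>S t by (intro mult_neg_pos) auto
  finally show False by simp
qed

section \<open>Smoothing by iterated averages\<close>

lemma antiderivative_on_interval:
  fixes f :: "real \<Rightarrow> real"
  assumes "continuous_on {0<..<R} f"
  shows "\<exists>\<Phi>. \<forall>x. 0 < x \<longrightarrow> x < R \<longrightarrow> (\<Phi> has_real_derivative f x) (at x)"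
proof (cases "0 < R")
  case True
  have "\<exists>F. \<forall>x::real. 0 < ereal x \<longrightarrow> ereal x < ereal R \<longrightarrow> (F has_vector_derivative f x) (at x)"
    by (rule einterval_antiderivative)
       (use True assms in \<open>auto simp: continuous_on_eq_continuous_at\<close>)
  then show ?thesis
    by (simp add: has_real_derivative_iff_has_vector_derivative)
qed auto

text \<open>Each step replaces a function by its mean over \<open>[x, x + d]\<close>, written as the difference quotient
  \<open>(\<Phi> (x + d) - \<Phi> x) / d\<close> of an antiderivative. In this form the derivatives are difference quotients
  of the previous ones, positivity is monotonicity of a quadratic form in \<open>\<Phi>\<close>, and the mean value
  theorem shows that the new values are still values of \<open>f\<close> at nearby points, which gives convergence
  as \<open>d\<close> tends to \<open>0\<close> without uniform estimates.\<close>

lemma smoothing: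
  assumes u: "0 < u" "u < 1" and f: "continuous_on {0<..<R} f" "hankel_psd N u R f" and d: "0 < d"
  shows "\<exists>D. (\<forall>x\<in>{0<..<R - real m * d}. \<forall>k<m. (D k has_real_derivative D (Suc k) x) (at x)) \<and>
             continuous_on {0<..<R - real m * d} (D m) \<and>
             hankel_psd N u (R - real m * d) (D 0) \<and>
             (\<forall>x\<in>{0<..<R - real m * d}. \<exists>\<xi>\<in>{x..x + real m * d}. D 0 x = f \<xi>)"
proof (induction m)
  case 0
  show ?case using f by (intro exI[of _ "\<lambda>_. f"]) auto
next
  case (Suc m)
  define r where "r = R - real m * d"
  have r: "R - real (Suc m) * d = r - d" by (simp add: r_def algebra_simps)
  obtain D where step: "\<forall>x\<in>{0<..<r}. \<forall>k<m. (D k has_real_derivative D (Suc k) x) (at x)"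
    and Dm: "continuous_on {0<..<r} (D m)"
    and psd: "hankel_psd N u r (D 0)"
    and mean: "\<forall>x\<in>{0<..<r}. \<exists>\<xi>\<in>{x..x + real m * d}. D 0 x = f \<xi>"
    using Suc.IH unfolding r_def[symmetric] by (elim exE conjE) (rule that)
  have D: "(D k has_real_derivative D (Suc k) x) (at x)" if "0 < x" "x < r" "k < m" for x k
    using step that by simp
  have mv: "\<exists>\<xi>\<in>{x..x + real m * d}. D 0 x = f \<xi>" if "0 < x" "x < r" for x
    using mean that by simp
  have "continuous_on {0<..<r} (D 0)"
  proof (cases "m = 0")
    case False
    then have "isCont (D 0) x" if "x \<in> {0<..<r}" for x
      using D[of x 0] that by (auto intro: DERIV_isCont)
    then show ?thesis by (simp add: continuous_on_eq_continuous_at)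
  qed (use Dm in auto)
  then obtain \<Phi> where \<Phi>: "\<And>x. 0 < x \<Longrightarrow> x < r \<Longrightarrow> (\<Phi> has_real_derivative D 0 x) (at x)"
    using antiderivative_on_interval by metis
  define avg where "avg g x = (g (x + d) - g x) / d" for g :: "real \<Rightarrow> real" and x
  have avg_deriv: "(avg g has_real_derivative avg g' x) (at x)"
    if x: "0 < x" "x < r - d" and g: "\<And>y. 0 < y \<Longrightarrow> y < r \<Longrightarrow> (g has_real_derivative g' y) (at y)"
    for g g' x
  proof -
    have "((\<lambda>x. g (x + d)) has_real_derivative g' (x + d)) (at x)"
      using g[of "x + d"] x d by (simp add: DERIV_shift)
    moreover have "(g has_real_derivative g' x) (at x)" using g[of x] x d by simp
    ultimately show ?thesis unfolding avg_def by (intro DERIV_cdivide DERIV_diff)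
  qed
  define D' where "D' k = (case k of 0 \<Rightarrow> avg \<Phi> | Suc i \<Rightarrow> avg (D i))" for k
  have "(D' k has_real_derivative D' (Suc k) x) (at x)" if "0 < x" "x < r - d" "k < Suc m" for x k
    using that avg_deriv[OF that(1,2)] \<Phi> D
    by (cases k) (auto simp: D'_def)
  moreover have "continuous_on {0<..<r - d} (D' (Suc m))"
    unfolding D'_def avg_def nat.case
    by (intro continuous_intros continuous_on_compose2[OF Dm]) (use d in auto)
  moreover have "hankel_psd N u (r - d) (D' 0)"
    unfolding hankel_psd_def
  proof safe
    fix v a b assume ab: "0 < a" "0 < b" "a + b < r - d"
    let ?Q = "\<lambda>y. \<Sum>p<N. \<Sum>q<N. v p * v q * \<Phi> (y + b * u ^ (p + q))"
    \<comment> \<open>The derivative of ?Q is the quadratic form of D 0, which is nonnegative by the induction hypothesis.\<close>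
    have "?Q a \<le> ?Q (a + d)"
    proof (rule DERIV_nonneg_imp_nondecreasing[where f = ?Q])
      fix y assume y: "a \<le> y" "y \<le> a + d"
      have "(?Q has_real_derivative (\<Sum>p<N. \<Sum>q<N. v p * v q * D 0 (y + b * u ^ (p + q)))) (at y)"
      proof (intro DERIV_sum DERIV_cmult)
        fix p q
        have "(\<Phi> has_real_derivative D 0 (y + b * u ^ (p + q))) (at (y + b * u ^ (p + q)))"
          using hankel_arg_in_interval[OF u ab(2), of y "p + q"] y ab by (intro \<Phi>) linarith+
        then show "((\<lambda>y. \<Phi> (y + b * u ^ (p + q))) has_real_derivative D 0 (y + b * u ^ (p + q))) (at y)"
          by (simp add: DERIV_shift)
      qed
      moreover have "0 \<le> (\<Sum>p<N. \<Sum>q<N. v p * v q * D 0 (y + b * u ^ (p + q)))"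
        using psd by (rule hankel_psdD) (use y ab in auto)
      ultimately show "\<exists>z. (?Q has_real_derivative z) (at y) \<and> 0 \<le> z" by blast
    qed (use d in auto)
    then have "0 \<le> (?Q (a + d) - ?Q a) / d" using d by simp
    also have "\<dots> = (\<Sum>p<N. \<Sum>q<N. v p * v q * D' 0 (a + b * u ^ (p + q)))"
      by (simp add: D'_def avg_def sum_subtractf[symmetric] sum_divide_distrib algebra_simps
          diff_divide_distrib)
    finally show "0 \<le> (\<Sum>p<N. \<Sum>q<N. v p * v q * D' 0 (a + b * u ^ (p + q)))" .
  qed
  moreover have "\<exists>\<xi>\<in>{x..x + real (Suc m) * d}. D' 0 x = f \<xi>" if x: "0 < x" "x < r - d" for x
  proof -
    obtain z where z: "x < z" "z < x + d" "\<Phi> (x + d) - \<Phi> x = (x + d - x) * D 0 z"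
      using MVT2[of x "x + d" \<Phi> "D 0"] \<Phi> x d by auto
    obtain \<xi> where \<xi>: "\<xi> \<in> {z..z + real m * d}" "D 0 z = f \<xi>" using mv[of z] z x by auto
    have "D' 0 x = f \<xi>" using z \<xi> d by (simp add: D'_def avg_def)
    moreover have "\<xi> \<in> {x..x + real (Suc m) * d}" using \<xi> z by (auto simp: algebra_simps)
    ultimately show ?thesis by blast
  qed
  ultimately show ?case unfolding r by (intro exI[of _ D']) auto
qed

section \<open>Limits of functions with nonnegative derivatives\<close>

text \<open>Moving one step \<open>h\<close> to the right turns a bound on a function into a bound on its derivative, since
  the derivative is nondecreasing and the function is nonnegative; two steps bound the second derivative.\<close>

lemma second_deriv_bound:
  fixes g g' g'' g''' :: "real \<Rightarrow> real"
  assumes g: "\<And>y. 0 < y \<Longrightarrow> y < b \<Longrightarrow> (g has_real_derivative g' y) (at y)"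
    and g': "\<And>y. 0 < y \<Longrightarrow> y < b \<Longrightarrow> (g' has_real_derivative g'' y) (at y)"
    and g'': "\<And>y. 0 < y \<Longrightarrow> y < b \<Longrightarrow> (g'' has_real_derivative g''' y) (at y)"
    and nonneg: "\<And>y. 0 < y \<Longrightarrow> y < b \<Longrightarrow> 0 \<le> g y \<and> 0 \<le> g' y \<and> 0 \<le> g'' y \<and> 0 \<le> g''' y"
    and z: "0 < y" "y \<le> z" "z + 2 * h < b" "0 < h"
  shows "g'' y \<le> g (z + 2 * h) / h\<^sup>2"
proof -
  have mono'': "g'' s \<le> g'' t" if st: "0 < s" "s \<le> t" "t < b" for s t
  proof (rule DERIV_nonneg_imp_nondecreasing[OF st(2)])
    fix r assume "s \<le> r" "r \<le> t"
    then have "0 < r" "r < b" using st by auto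
    then show "\<exists>l. (g'' has_real_derivative l) (at r) \<and> 0 \<le> l" using g'' nonneg by blast
  qed
  have mono': "g' s \<le> g' t" if st: "0 < s" "s \<le> t" "t < b" for s t
  proof (rule DERIV_nonneg_imp_nondecreasing[OF st(2)])
    fix r assume "s \<le> r" "r \<le> t"
    then have "0 < r" "r < b" using st by auto
    then show "\<exists>l. (g' has_real_derivative l) (at r) \<and> 0 \<le> l" using g' nonneg by blast
  qed
  obtain s where s: "z < s" "s < z + h" "g' (z + h) - g' z = (z + h - z) * g'' s"
    using MVT2[of z "z + h" g' g''] g' z by auto
  obtain t where t: "z + h < t" "t < z + 2 * h" "g (z + 2 * h) - g (z + h) = (z + 2 * h - (z + h)) * g' t"
    using MVT2[of "z + h" "z + 2 * h" g g'] g z by auto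
  have "h * g'' y \<le> h * g'' s" using mono''[of y s] s z by simp
  also have "\<dots> \<le> g' (z + h)" using s nonneg[of z] z by auto
  also have "\<dots> \<le> g' t" using mono'[of "z + h" t] t z by simp
  finally have "h * (h * g'' y) \<le> h * g' t" using z by simp
  also have "\<dots> \<le> g (z + 2 * h)" using t nonneg[of "z + h"] z by auto
  finally show ?thesis using z by (simp add: field_simps power2_eq_square)
qed

lemma convergent_if_eventually_close:
  fixes a :: "nat \<Rightarrow> real"
  assumes "\<And>e. 0 < e \<Longrightarrow> \<exists>q. \<forall>\<^sub>F j in sequentially. \<bar>a j - q\<bar> \<le> e"
  shows "convergent a"
proof -
  have "Cauchy a"
  proof (rule metric_CauchyI)
    fix e :: real assume e: "0 < e"
    then obtain q where "\<forall>\<^sub>F j in sequentially. \<bar>a j - q\<bar> \<le> e / 3" using assms[of "e / 3"] by auto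
    then obtain M where M: "\<And>j. M \<le> j \<Longrightarrow> \<bar>a j - q\<bar> \<le> e / 3"
      by (auto simp: eventually_sequentially)
    have "dist (a i) (a j) < e" if "M \<le> i" "M \<le> j" for i j
      using M[OF that(1)] M[OF that(2)] e unfolding dist_real_def by linarith
    then show "\<exists>M. \<forall>i\<ge>M. \<forall>j\<ge>M. dist (a i) (a j) < e" by blast
  qed
  then show ?thesis by (rule Cauchy_convergent)
qed

text \<open>Near \<open>x\<close> the second derivatives are eventually bounded by a constant \<open>C\<close> that depends only on the
  limit function. Hence the difference quotients of \<open>g j\<close> with increment \<open>s\<close> approximate \<open>g' j x\<close> up
  to \<open>C * \<bar>s\<bar>\<close>, uniformly in \<open>j\<close>; exchanging the limits in \<open>j\<close> and \<open>s\<close> gives both claims. The third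
  derivative serves to make \<open>g''\<close> nondecreasing, so that one bound holds on a neighbourhood of \<open>x\<close>.\<close>

lemma deriv_of_limit:
  fixes g g' g'' g''' :: "nat \<Rightarrow> real \<Rightarrow> real"
  assumes x: "0 < x" "x < R"
    and ev: "\<And>b. b < R \<Longrightarrow> \<forall>\<^sub>F j in sequentially. \<forall>y\<in>{0<..<b}.
        (g j has_real_derivative g' j y) (at y) \<and> (g' j has_real_derivative g'' j y) (at y) \<and>
        (g'' j has_real_derivative g''' j y) (at y) \<and>
        0 \<le> g j y \<and> 0 \<le> g' j y \<and> 0 \<le> g'' j y \<and> 0 \<le> g''' j y"
    and lim: "\<And>y. 0 < y \<Longrightarrow> y < R \<Longrightarrow> (\<lambda>j. g j y) \<longlonglongrightarrow> G y"
  shows "convergent (\<lambda>j. g' j x)" "(G has_real_derivative lim (\<lambda>j. g' j x)) (at x)"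
proof -
  define h where "h = (R - x) / 4"
  have h: "0 < h" "x + 3 * h < R" using x by (auto simp: h_def field_simps)
  define C where "C = (\<bar>G (x + 3 * h)\<bar> + 1) / h\<^sup>2"
  have C: "0 \<le> C" by (simp add: C_def)
  define d where "d = min h (x / 2)"
  have d: "0 < d" "d \<le> h" "d < x" using h x by (auto simp: d_def)
  obtain b where b: "x + 3 * h < b" "b < R" using dense[OF h(2)] by blast
  have "\<forall>\<^sub>F j in sequentially. g j (x + 3 * h) < \<bar>G (x + 3 * h)\<bar> + 1"
    using h x by (intro order_tendstoD(2)[OF lim]) auto
  with ev[OF b(2)] have tay: "\<forall>\<^sub>F j in sequentially. \<forall>s. s \<noteq> 0 \<longrightarrow> \<bar>s\<bar> \<le> d \<longrightarrow>
      \<bar>g j (x + s) - g j x - s * g' j x\<bar> \<le> C * s\<^sup>2"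
  proof eventually_elim
    case (elim j)
    have bound: "0 \<le> g'' j y" "g'' j y \<le> C" if y: "0 < y" "y \<le> x + h" for y
    proof -
      show "0 \<le> g'' j y" using elim y b h by auto
      have "g'' j y \<le> g j (x + h + 2 * h) / h\<^sup>2"
        by (rule second_deriv_bound[where b = b and g' = "g' j" and g''' = "g''' j"])
           (use elim y b h in auto)
      also have "x + h + 2 * h = x + 3 * h" by simp
      also have "g j (x + 3 * h) / h\<^sup>2 \<le> C"
        unfolding C_def using elim by (intro divide_right_mono) auto
      finally show "g'' j y \<le> C" .
    qed
    show ?case
    proof (intro allI impI)
      fix s assume s: "s \<noteq> 0" "\<bar>s\<bar> \<le> d"
      let ?D = "\<lambda>m::nat. if m = 0 then g j else if m = 1 then g' j else g'' j"
      have "\<exists>t. (if x + s < x then x + s < t \<and> t < x else x < t \<and> t < x + s) \<and>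
          g j (x + s) = (\<Sum>m<2. (?D m x / fact m) * (x + s - x)^m) + (?D 2 t / fact 2) * (x + s - x)^2"
        by (rule Taylor[where a = "x - d" and b = "x + d"])
           (use elim s d b h in \<open>auto simp: less_2_cases_iff\<close>)
      then obtain t where between: "if x + s < x then x + s < t \<and> t < x else x < t \<and> t < x + s"
        and expand: "g j (x + s) =
          (\<Sum>m<2. (?D m x / fact m) * (x + s - x)^m) + (?D 2 t / fact 2) * (x + s - x)^2"
        by blast
      have t: "0 < t" "t \<le> x + h" using between s d by (auto split: if_splits)
      have "g j (x + s) - g j x - s * g' j x = g'' j t * s\<^sup>2 / 2"
        using expand by (simp add: numeral_2_eq_2)
      then show "\<bar>g j (x + s) - g j x - s * g' j x\<bar> \<le> C * s\<^sup>2"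
        using mult_right_mono[OF bound(2)[OF t], of "s\<^sup>2"]
          mult_nonneg_nonneg[OF bound(1)[OF t], of "s\<^sup>2"] by simp
    qed
  qed
  define q where "q s = (G (x + s) - G x) / s" for s
  have close: "\<forall>\<^sub>F j in sequentially. \<bar>g' j x - q s\<bar> \<le> (C + 1) * \<bar>s\<bar>" if s: "s \<noteq> 0" "\<bar>s\<bar> \<le> d" for s
  proof -
    have "(\<lambda>j. (g j (x + s) - g j x) / s) \<longlonglongrightarrow> q s"
      unfolding q_def using s d h x by (intro tendsto_intros lim) auto
    then have "\<forall>\<^sub>F j in sequentially. dist ((g j (x + s) - g j x) / s) (q s) < \<bar>s\<bar>"
      using s by (intro tendstoD) auto
    with tay show ?thesis
    proof eventually_elim
      case (elim j)
      have "\<bar>(g j (x + s) - g j x) / s - g' j x\<bar> = \<bar>g j (x + s) - g j x - s * g' j x\<bar> / \<bar>s\<bar>"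
        using s by (simp add: abs_divide[symmetric] diff_divide_distrib)
      also have "\<dots> \<le> C * s\<^sup>2 / \<bar>s\<bar>"
        using elim(1) s by (intro divide_right_mono) simp_all
      also have "s\<^sup>2 = \<bar>s\<bar> * \<bar>s\<bar>" by (simp add: power2_eq_square)
      also have "C * (\<bar>s\<bar> * \<bar>s\<bar>) / \<bar>s\<bar> = C * \<bar>s\<bar>"
        using s by (simp del: abs_mult_self_eq)
      finally have "\<bar>g' j x - q s\<bar> \<le> C * \<bar>s\<bar> + \<bar>s\<bar>"
        using elim(2) unfolding dist_real_def by linarith
      then show ?case by (simp add: distrib_right)
    qed
  qed
  show conv: "convergent (\<lambda>j. g' j x)"
  proof (rule convergent_if_eventually_close)
    fix e :: real assume e: "0 < e"
    define s where "s = min d (e / (C + 1))"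
    have s: "0 < s" "s \<le> d" using d e C by (auto simp: s_def)
    have "(C + 1) * s \<le> (C + 1) * (e / (C + 1))"
      using C by (intro mult_left_mono) (auto simp: s_def)
    also have "\<dots> = e" using C by simp
    finally have se: "(C + 1) * s \<le> e" .
    have "\<forall>\<^sub>F j in sequentially. \<bar>g' j x - q s\<bar> \<le> e"
      using close[of s] s se by (auto elim!: eventually_mono)
    then show "\<exists>q. \<forall>\<^sub>F j in sequentially. \<bar>g' j x - q\<bar> \<le> e" by blast
  qed
  let ?L = "lim (\<lambda>j. g' j x)"
  have L: "(\<lambda>j. g' j x) \<longlonglongrightarrow> ?L" using conv by (simp add: convergent_LIMSEQ_iff)
  have qL: "\<bar>q s - ?L\<bar> \<le> (C + 1) * \<bar>s\<bar>" if "s \<noteq> 0" "\<bar>s\<bar> \<le> d" for s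
  proof -
    have "(\<lambda>j. \<bar>g' j x - q s\<bar>) \<longlonglongrightarrow> \<bar>?L - q s\<bar>" using L by (intro tendsto_intros)
    then have "\<bar>?L - q s\<bar> \<le> (C + 1) * \<bar>s\<bar>"
      using close[OF that] by (rule tendsto_upperbound) simp
    then show ?thesis by (simp add: abs_minus_commute)
  qed
  have "((\<lambda>s. q s - ?L) \<longlongrightarrow> 0) (at 0)"
  proof (rule Lim_null_comparison)
    show "\<forall>\<^sub>F s in at 0. norm (q s - ?L) \<le> (C + 1) * \<bar>s\<bar>"
      unfolding eventually_at using d qL by (intro exI[of _ d]) (auto simp: dist_real_def)
    show "((\<lambda>s. (C + 1) * \<bar>s\<bar>) \<longlongrightarrow> 0) (at 0)" by (auto intro!: tendsto_eq_intros)
  qed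
  then show "(G has_real_derivative ?L) (at x)"
    unfolding DERIV_def q_def by (simp add: LIM_zero_iff)
qed

lemma nth_deriv_eq:
  fixes E :: "nat \<Rightarrow> real \<Rightarrow> real"
  assumes S: "open S" and E0: "\<And>x. x \<in> S \<Longrightarrow> E 0 x = f x"
    and E: "\<And>k x. k < n \<Longrightarrow> x \<in> S \<Longrightarrow> (E k has_real_derivative E (Suc k) x) (at x)"
  shows "k \<le> n \<Longrightarrow> x \<in> S \<Longrightarrow> nth_deriv k f x = E k x"
    and "k < n \<Longrightarrow> x \<in> S \<Longrightarrow> nth_deriv k f field_differentiable at x"
proof -
  have eq: "\<forall>x\<in>S. nth_deriv k f x = E k x" if "k \<le> n" for k
    using that
  proof (induction k)
    case 0
    then show ?case using E0 by (simp add: nth_deriv_def)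
  next
    case (Suc k)
    have "(nth_deriv k f has_real_derivative E (Suc k) x) (at x)" if "x \<in> S" for x
      by (rule has_field_derivative_transform_within_open[OF E[of k x] S])
         (use Suc that in auto)
    then show ?case by (auto simp: nth_deriv_def intro: DERIV_imp_deriv)
  qed
  then show "k \<le> n \<Longrightarrow> x \<in> S \<Longrightarrow> nth_deriv k f x = E k x" by blast
  assume k: "k < n" "x \<in> S"
  have "(nth_deriv k f has_real_derivative E (Suc k) x) (at x)"
    by (rule has_field_derivative_transform_within_open[OF E[of k x] S]) (use k eq in auto)
  then show "nth_deriv k f field_differentiable at x" by (auto simp: field_differentiable_def)
qed

text \<open>The conclusion of the theorem at order \<open>m\<close>. Convexity and monotonicity of the top derivative are
  what remains of two further nonnegative derivatives after a pointwise limit.\<close>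

definition monotone_to_order :: "nat \<Rightarrow> (real \<Rightarrow> real) \<Rightarrow> real set \<Rightarrow> bool" where
  "monotone_to_order m f S \<longleftrightarrow>
     Ck_on m f S \<and> (\<forall>k\<le>m. \<forall>x\<in>S. 0 \<le> nth_deriv k f x) \<and>
     convex_on S (nth_deriv m f) \<and> mono_on S (nth_deriv m f)"

text \<open>Passing to the limit costs two derivatives: the convergence of the derivatives of order \<open>k + 1\<close> uses
  nonnegativity up to order \<open>k + 3\<close>, hence convergence is obtained only up to order \<open>m\<close>.\<close>

lemma limit_monotone_to_order:
  fixes D :: "nat \<Rightarrow> nat \<Rightarrow> real \<Rightarrow> real"
  assumes ev: "\<And>b. b < R \<Longrightarrow> \<forall>\<^sub>F j in sequentially. \<forall>y\<in>{0<..<b}.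
        (\<forall>k<m + 2. (D j k has_real_derivative D j (Suc k) y) (at y)) \<and> (\<forall>k\<le>m + 2. 0 \<le> D j k y)"
    and lim: "\<And>y. 0 < y \<Longrightarrow> y < R \<Longrightarrow> (\<lambda>j. D j 0 y) \<longlonglongrightarrow> f y"
  shows "monotone_to_order m f {0<..<R}"
proof -
  define E where "E k x = lim (\<lambda>j. D j k x)" for k x
  have step: "convergent (\<lambda>j. D j (Suc k) x)" "(E k has_real_derivative E (Suc k) x) (at x)"
    if k: "k < m" and x: "0 < x" "x < R" and L: "\<And>y. 0 < y \<Longrightarrow> y < R \<Longrightarrow> (\<lambda>j. D j k y) \<longlonglongrightarrow> E k y"
    for k x
  proof -
    have ev': "\<forall>\<^sub>F j in sequentially. \<forall>y\<in>{0<..<b}.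
        (D j k has_real_derivative D j (Suc k) y) (at y) \<and>
        (D j (Suc k) has_real_derivative D j (Suc (Suc k)) y) (at y) \<and>
        (D j (Suc (Suc k)) has_real_derivative D j (Suc (Suc (Suc k))) y) (at y) \<and>
        0 \<le> D j k y \<and> 0 \<le> D j (Suc k) y \<and> 0 \<le> D j (Suc (Suc k)) y \<and>
        0 \<le> D j (Suc (Suc (Suc k))) y" if "b < R" for b
      using ev[OF that] by (rule eventually_mono) (use k in auto)
    note lim = deriv_of_limit[of x R "\<lambda>j. D j k" "\<lambda>j. D j (Suc k)", OF x ev' L]
    show "convergent (\<lambda>j. D j (Suc k) x)" by (rule lim)
    show "(E k has_real_derivative E (Suc k) x) (at x)" unfolding E_def[of "Suc k"] by (rule lim)
  qed
  have L: "\<forall>x. 0 < x \<longrightarrow> x < R \<longrightarrow> (\<lambda>j. D j k x) \<longlonglongrightarrow> E k x" if "k \<le> m" for k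
    using that
  proof (induction k)
    case 0
    then show ?case using lim limI unfolding E_def by metis
  next
    case (Suc k)
    then have "convergent (\<lambda>j. D j (Suc k) x)" if "0 < x" "x < R" for x
      using that by (intro step(1)) auto
    then show ?case by (simp add: E_def convergent_LIMSEQ_iff)
  qed
  have E0: "E 0 x = f x" if "x \<in> {0<..<R}" for x
    using that lim[of x] limI unfolding E_def by auto
  have E: "(E k has_real_derivative E (Suc k) x) (at x)" if "k < m" "x \<in> {0<..<R}" for k x
    using that L[of k] by (intro step(2)) auto
  note eq = nth_deriv_eq[of "{0<..<R}" E f m, OF open_greaterThanLessThan E0 E]
  have nonneg: "0 \<le> E k x" if "k \<le> m" "x \<in> {0<..<R}" for k x
  proof -
    have "x < R" using that by simp
    then obtain b where b: "x < b" "b < R" using dense by blast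
    have "\<forall>\<^sub>F j in sequentially. 0 \<le> D j k x"
      using ev[OF b(2)] by (rule eventually_mono) (use b that in auto)
    then show ?thesis using L[OF that(1)] that by (intro tendsto_lowerbound) auto
  qed
  have mono: "E m x \<le> E m y" if x: "0 < x" "x \<le> y" "y < R" for x y
  proof -
    obtain b where b: "y < b" "b < R" using dense[OF x(3)] by blast
    have "\<forall>\<^sub>F j in sequentially. D j m x \<le> D j m y"
      using ev[OF b(2)]
    proof eventually_elim
      case (elim j)
      show ?case
      proof (rule DERIV_nonneg_imp_nondecreasing[OF x(2)])
        fix z assume "x \<le> z" "z \<le> y"
        then show "\<exists>l. (D j m has_real_derivative l) (at z) \<and> 0 \<le> l"
          using elim x b by (intro exI[of _ "D j (Suc m) z"]) auto
      qed
    qed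
    then show ?thesis using L[of m] x by (intro tendsto_le[OF sequentially_bot]) auto
  qed
  have convex: "convex_on {0<..<R} (E m)"
  proof (rule convex_onI)
    fix t x y :: real
    assume t: "0 < t" "t < 1" and x: "x \<in> {0<..<R}" and y: "y \<in> {0<..<R}"
    have "max x y < R" using x y by simp
    then obtain b where b: "max x y < b" "b < R" using dense by blast
    let ?z = "(1 - t) *\<^sub>R x + t *\<^sub>R y"
    have z: "?z \<in> {0<..<R}"
      using convexD_alt[OF convex_real_interval(8) x y, of t] t by simp
    have "\<forall>\<^sub>F j in sequentially. D j m ?z \<le> (1 - t) * D j m x + t * D j m y"
      using ev[OF b(2)]
    proof eventually_elim
      case (elim j)
      have "convex_on {0<..<b} (D j m)"
        by (rule f''_ge0_imp_convex[where f' = "D j (Suc m)" and f'' = "D j (Suc (Suc m))"])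
           (use elim in auto)
      then show ?case by (rule convex_onD) (use t x y b in auto)
    qed
    moreover have "(\<lambda>j. (1 - t) * D j m x + t * D j m y) \<longlonglongrightarrow> (1 - t) * E m x + t * E m y"
      using L[of m] x y by (intro tendsto_intros) auto
    moreover have "(\<lambda>j. D j m ?z) \<longlonglongrightarrow> E m ?z" using L[of m] z by auto
    ultimately show "E m ?z \<le> (1 - t) * E m x + t * E m y"
      by (intro tendsto_le[OF sequentially_bot])
  qed auto
  have convex': "convex_on {0<..<R} (nth_deriv m f)"
    using convex eq(1)[of m] convexD[OF convex_on_imp_convex[OF convex]]
    unfolding convex_on_def by (metis order_refl)
  then have "continuous_on {0<..<R} (nth_deriv m f)"
    by (intro convex_on_continuous) auto
  then show ?thesis
    unfolding monotone_to_order_def Ck_on_def mono_on_def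
    using eq nonneg mono convex' by auto
qed

section \<open>The theorem for continuous functions\<close>

lemma continuous_hankel_psd_imp_monotone:
  fixes u :: real
  assumes u: "0 < u" "u < 1" and cont: "continuous_on {0<..<R} f" and psd: "hankel_psd (m + 3) u R f"
  shows "monotone_to_order m f {0<..<R}"
proof -
  define \<delta> where "\<delta> j = inverse (real (Suc j))" for j
  have \<delta>: "0 < \<delta> j" for j by (simp add: \<delta>_def)
  have \<delta>_lim: "(\<lambda>j. real (m + 2) * \<delta> j) \<longlonglongrightarrow> 0"
    unfolding \<delta>_def by (rule tendsto_mult_right_zero[OF LIMSEQ_inverse_real_of_nat])
  define smooth where "smooth j D \<longleftrightarrow>
      (\<forall>x\<in>{0<..<R - real (m + 2) * \<delta> j}. \<forall>k<m + 2. (D k has_real_derivative D (Suc k) x) (at x)) \<and>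
      continuous_on {0<..<R - real (m + 2) * \<delta> j} (D (m + 2)) \<and>
      hankel_psd (m + 3) u (R - real (m + 2) * \<delta> j) (D 0) \<and>
      (\<forall>x\<in>{0<..<R - real (m + 2) * \<delta> j}. \<exists>\<xi>\<in>{x..x + real (m + 2) * \<delta> j}. D 0 x = f \<xi>)"
    for j and D :: "nat \<Rightarrow> real \<Rightarrow> real"
  have "\<exists>D. smooth j D" for j
    unfolding smooth_def by (rule smoothing[OF u cont psd \<delta>])
  then obtain D where S: "smooth j (D j)" for j by metis
  have D: "(D j k has_real_derivative D j (Suc k) x) (at x)"
    if "0 < x" "x < R - real (m + 2) * \<delta> j" "k < m + 2" for j k x
    using S[of j] that unfolding smooth_def by auto
  have Dc: "continuous_on {0<..<R - real (m + 2) * \<delta> j} (D j (m + 2))"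
    and Dp: "hankel_psd (m + 3) u (R - real (m + 2) * \<delta> j) (D j 0)" for j
    using S[of j] unfolding smooth_def by auto
  have Dv: "\<exists>\<xi>\<in>{x..x + real (m + 2) * \<delta> j}. D j 0 x = f \<xi>"
    if "0 < x" "x < R - real (m + 2) * \<delta> j" for j x
    using S[of j] that unfolding smooth_def by auto
  have nonneg: "0 \<le> D j k x" if x: "0 < x" "x < R - real (m + 2) * \<delta> j" and k: "k \<le> m + 2" for j k x
  proof (rule hankel_psd_imp_deriv_nonneg[where D = "D j", OF u _ Dp x])
    show "isCont (D j k) x"
    proof (cases "k = m + 2")
      case True
      then show ?thesis using Dc x by (simp add: continuous_on_eq_continuous_at)
    qed (use D[OF x, of k] k in \<open>auto intro: DERIV_isCont\<close>)
  qed (use k D in auto)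
  show ?thesis
  proof (rule limit_monotone_to_order)
    fix b assume "b < R"
    then have "\<forall>\<^sub>F j in sequentially. real (m + 2) * \<delta> j < R - b"
      by (intro order_tendstoD(2)[OF \<delta>_lim]) auto
    then show "\<forall>\<^sub>F j in sequentially. \<forall>y\<in>{0<..<b}.
        (\<forall>k<m + 2. (D j k has_real_derivative D j (Suc k) y) (at y)) \<and> (\<forall>k\<le>m + 2. 0 \<le> D j k y)"
    proof eventually_elim
      case (elim j)
      then have "y < R - real (m + 2) * \<delta> j" if "y < b" for y using that by linarith
      then show ?case using D nonneg by auto
    qed
  next
    fix y assume y: "0 < y" "y < R"
    show "(\<lambda>j. D j 0 y) \<longlonglongrightarrow> f y"
    proof (rule tendstoI)
      fix e :: real assume "0 < e"
      moreover have "isCont f y" using cont y by (simp add: continuous_on_eq_continuous_at)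
      ultimately obtain d where d: "0 < d" "\<And>z. dist z y < d \<Longrightarrow> dist (f z) (f y) < e"
        unfolding continuous_at_eps_delta by blast
      have "\<forall>\<^sub>F j in sequentially. real (m + 2) * \<delta> j < min d (R - y)"
        using d y by (intro order_tendstoD(2)[OF \<delta>_lim]) auto
      then show "\<forall>\<^sub>F j in sequentially. dist (D j 0 y) (f y) < e"
      proof eventually_elim
        case (elim j)
        then obtain \<xi> where "\<xi> \<in> {y..y + real (m + 2) * \<delta> j}" "D j 0 y = f \<xi>"
          using Dv[of y j] y by auto
        then show ?case using d(2)[of \<xi>] elim by (auto simp: dist_real_def)
      qed
    qed
  qed
qed

lemma Ck_hankel_psd_imp_nonneg:
  assumes u: "0 < u" "u < 1" and psd: "hankel_psd N u R f" and C: "Ck_on n f {0<..<R}"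
    and k: "k \<le> n" "k < N" and x: "0 < x" "x < R"
  shows "0 \<le> nth_deriv k f x"
proof (rule hankel_psd_imp_deriv_nonneg[where D = "\<lambda>k. nth_deriv k f", OF u k(2) _ x])
  show "hankel_psd N u R (nth_deriv 0 f)" using psd by (simp add: nth_deriv_def)
  have diff: "nth_deriv i f field_differentiable at y" if "i < n" "0 < y" "y < R" for i y
    using C that by (simp add: Ck_on_def)
  show "(nth_deriv i f has_real_derivative nth_deriv (Suc i) f y) (at y)"
    if "i < k" "0 < y" "y < R" for i y
    using diff[of i y] that k by (simp add: nth_deriv_def DERIV_deriv_iff_field_differentiable)
  show "isCont (nth_deriv k f) x"
  proof (cases "k = n")
    case True
    then show ?thesis using C x by (simp add: Ck_on_def continuous_on_eq_continuous_at)
  qed (use diff[of k x] k x in \<open>auto intro: field_differentiable_imp_continuous_at\<close>)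
qed

section \<open>Positivity preservers in dimension two are continuous\<close>

definition sym2 :: "real \<Rightarrow> real \<Rightarrow> real \<Rightarrow> real mat" where
  "sym2 a b c = mat 2 2 (\<lambda>(i, j). if i \<noteq> j then b else if i = 0 then a else c)"

lemma sym2_psd_iff:
  "sym2 a b c \<in> psd_mats 2 S \<longleftrightarrow> {a, b, c} \<subseteq> S \<and> (\<forall>x y. 0 \<le> a * x\<^sup>2 + 2 * b * x * y + c * y\<^sup>2)"
proof -
  have entries: "elements_mat (sym2 a b c) = {a, b, c}"
  proof
    show "elements_mat (sym2 a b c) \<subseteq> {a, b, c}"
      unfolding elements_mat_def sym2_def by auto
    have "sym2 a b c $$ (i, j) \<in> elements_mat (sym2 a b c)" if "i < 2" "j < 2" for i j
      by (rule elements_matI[of _ 2 2 i j]) (use that in \<open>auto simp: sym2_def\<close>)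
    from this[of 0 0] this[of 0 1] this[of 1 1]
    show "{a, b, c} \<subseteq> elements_mat (sym2 a b c)" by (simp add: sym2_def)
  qed
  have form: "v \<bullet> (sym2 a b c *\<^sub>v v) = a * (v $ 0)\<^sup>2 + 2 * b * v $ 0 * v $ 1 + c * (v $ 1)\<^sup>2"
    if "v \<in> carrier_vec 2" for v
    using that
    by (simp add: sym2_def scalar_prod_def numeral_2_eq_2 power2_eq_square algebra_simps)
  have "(\<forall>v\<in>carrier_vec 2. 0 \<le> v \<bullet> (sym2 a b c *\<^sub>v v)) \<longleftrightarrow>
      (\<forall>x y. 0 \<le> a * x\<^sup>2 + 2 * b * x * y + c * y\<^sup>2)" (is "?L \<longleftrightarrow> ?R")
  proof
    assume ?L
    show ?R
    proof (intro allI)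
      fix x y :: real
      let ?v = "Matrix.vec 2 (\<lambda>i. if i = 0 then x else y)"
      show "0 \<le> a * x\<^sup>2 + 2 * b * x * y + c * y\<^sup>2"
        using \<open>?L\<close>[rule_format, of ?v] form[of ?v] by simp
    qed
  qed (auto simp: form)
  moreover have "sym2 a b c \<in> carrier_mat 2 2" "transpose_mat (sym2 a b c) = sym2 a b c"
    by (auto simp: sym2_def)
  ultimately show ?thesis unfolding psd_mats_def mem_Collect_eq entries by blast
qed

lemma quadratic_form_nonneg_iff:
  fixes a b c :: real
  shows "(\<forall>x y. 0 \<le> a * x\<^sup>2 + 2 * b * x * y + c * y\<^sup>2) \<longleftrightarrow> 0 \<le> a \<and> 0 \<le> c \<and> b\<^sup>2 \<le> a * c" (is "?L \<longleftrightarrow> ?R")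
proof
  assume L: ?L
  have a: "0 \<le> a" using L[rule_format, of 1 0] by simp
  have c: "0 \<le> c" using L[rule_format, of 0 1] by simp
  have "b\<^sup>2 \<le> a * c"
  proof (cases "a = 0")
    case True
    \<comment> \<open>With a = 0 this point gives the value - 4 * b^2.\<close>
    then show ?thesis using L[rule_format, of "- (c + 1)" "2 * b"]
      by (simp add: power2_eq_square algebra_simps)
  next
    case False
    have "0 \<le> a * (a * c - b\<^sup>2)"
      using L[rule_format, of "- b" a] by (simp add: power2_eq_square algebra_simps)
    then show ?thesis using a False by (simp add: zero_le_mult_iff)
  qed
  then show ?R using a c by simp
next
  assume R: ?R
  show ?L
  proof (intro allI)
    fix x y
    show "0 \<le> a * x\<^sup>2 + 2 * b * x * y + c * y\<^sup>2"
    proof (cases "a = 0")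
      case True
      then show ?thesis using R by simp
    next
      case False
      have "0 \<le> (a * x + b * y)\<^sup>2 + (a * c - b\<^sup>2) * y\<^sup>2" using R by simp
      also have "\<dots> = a * (a * x\<^sup>2 + 2 * b * x * y + c * y\<^sup>2)"
        by (simp add: power2_eq_square algebra_simps)
      finally show ?thesis using R False by (simp add: zero_le_mult_iff)
    qed
  qed
qed

lemma psd2_preserver_ineq:
  assumes pres: "\<forall>A\<in>psd_mats 2 S. map_mat F A \<in> psd_mats 2 UNIV"
    and S: "a \<in> S" "b \<in> S" "c \<in> S" and abc: "0 \<le> a" "0 \<le> c" "b\<^sup>2 \<le> a * c"
  shows "0 \<le> F a" "(F b)\<^sup>2 \<le> F a * F c"
proof -
  have "sym2 a b c \<in> psd_mats 2 S" using S abc by (simp add: sym2_psd_iff quadratic_form_nonneg_iff)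
  moreover have "map_mat F (sym2 a b c) = sym2 (F a) (F b) (F c)"
    by (rule eq_matI) (auto simp: sym2_def)
  ultimately have "sym2 (F a) (F b) (F c) \<in> psd_mats 2 UNIV" using pres by force
  then show "0 \<le> F a" "(F b)\<^sup>2 \<le> F a * F c" by (auto simp: sym2_psd_iff quadratic_form_nonneg_iff)
qed

text \<open>The choice \<open>b \<le> a = c\<close> in the inequality shows that \<open>F\<close> is nondecreasing, so \<open>F\<close> has one-sided
  limits \<open>l \<le> F x \<le> L\<close> at \<open>x\<close>. Choosing \<open>y < x < z\<close> close to \<open>x\<close> with \<open>y * z > x\<^sup>2\<close>, the geometric mean
  of \<open>y\<close> and \<open>z\<close> lies to the right of \<open>x\<close>, and the inequality becomes \<open>L\<^sup>2 \<le> l * L\<close> in the limit; this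
  leaves no room for a jump.\<close>

lemma continuous_on_if_psd2_ineq:
  fixes F :: "real \<Rightarrow> real"
  assumes nonneg: "\<And>a. 0 < a \<Longrightarrow> a < R \<Longrightarrow> 0 \<le> F a"
    and ineq: "\<And>a b c. \<lbrakk>0 < a; a < R; 0 < b; b < R; 0 < c; c < R; b\<^sup>2 \<le> a * c\<rbrakk> \<Longrightarrow> (F b)\<^sup>2 \<le> F a * F c"
  shows "continuous_on {0<..<R} F"
proof -
  have mono: "F x \<le> F y" if "0 < x" "x \<le> y" "y < R" for x y
    using ineq[of y x y] nonneg[of x] nonneg[of y] that
    by (auto simp: power2_eq_square mult_mono intro: power2_le_imp_le)
  have "isCont F x" if x: "x \<in> {0<..<R}" for x
  proof -
    define l where "l = Sup (F ` {0<..<x})"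
    define L where "L = Inf (F ` {x<..<R})"
    have nl: "{0<..<x} \<noteq> {}" and nL: "{x<..<R} \<noteq> {}" using x by auto
    have bl: "bdd_above (F ` {0<..<x})" using x by (intro bdd_aboveI2[of _ _ "F x"] mono) auto
    have bL: "bdd_below (F ` {x<..<R})" using x by (intro bdd_belowI2[of _ "F x"] mono) auto
    have lx: "l \<le> F x" unfolding l_def using nl x by (intro cSUP_least mono) auto
    have Lx: "F x \<le> L" unfolding L_def using nL x by (intro cINF_greatest mono) auto
    have yl: "F y \<le> l" if "0 < y" "y < x" for y
      unfolding l_def using that by (intro cSUP_upper[OF _ bl]) auto
    have zL: "L \<le> F z" if "x < z" "z < R" for z
      unfolding L_def using that by (intro cINF_lower[OF bL]) auto
    have L0: "0 \<le> L" using Lx nonneg[of x] x by auto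
    have l0: "0 \<le> l" using yl[of "x / 2"] nonneg[of "x / 2"] x by auto
    have sq: "L\<^sup>2 \<le> l * F z" if z: "x < z" "z < R" for z
    proof -
      have "x * x < z * x" using z x by simp
      then have "x\<^sup>2 / z < x" using z x by (simp add: field_simps power2_eq_square)
      then obtain y where y: "x\<^sup>2 / z < y" "y < x" using dense by blast
      have y0: "0 < y" using y x z by (smt (verit) divide_pos_pos greaterThanLessThan_iff zero_less_power)
      let ?m = "sqrt (y * z)"
      have "x\<^sup>2 < y * z" using y z x by (simp add: field_simps)
      then have m: "x < ?m" using x by (simp add: real_less_rsqrt)
      have "y * z \<le> z\<^sup>2" using y z y0 by (simp add: power2_eq_square)
      then have m2: "?m \<le> z" using z x by (intro real_le_lsqrt) auto
      have "L\<^sup>2 \<le> (F ?m)\<^sup>2" using zL[of ?m] m m2 z L0 by (intro power_mono) auto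
      also have "\<dots> \<le> F y * F z" using m m2 x y y0 z by (intro ineq) auto
      also have "\<dots> \<le> l * F z" using yl[of y] y y0 nonneg[of z] z x by (intro mult_right_mono) auto
      finally show ?thesis .
    qed
    have "L \<le> l"
    proof (rule ccontr)
      assume "\<not> L \<le> l"
      then have lL: "l < L" by simp
      show False
      proof (cases "l = 0")
        case True
        have "x < R" using x by simp
        then obtain z where "x < z" "z < R" using dense by blast
        then have "L\<^sup>2 \<le> 0" using sq[of z] True by simp
        then show False using lL True by simp
      next
        case False
        then have "L\<^sup>2 / l \<le> F z" if "x < z" "z < R" for z
          using sq[OF that] l0 by (simp add: field_simps)
        then have "L\<^sup>2 / l \<le> L" unfolding L_def using nL by (intro cINF_greatest) auto
        then have "L * L \<le> L * l" using l0 False by (simp add: field_simps power2_eq_square)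
        then show False using lL l0 by simp
      qed
    qed
    then have eq: "l = F x" "L = F x" using lx Lx by auto
    show ?thesis
      unfolding continuous_at_eps_delta
    proof (intro allI impI)
      fix e :: real assume e: "0 < e"
      obtain y where y: "0 < y" "y < x" "F x - e < F y"
        using less_cSUP_iff[OF nl bl, of "F x - e"] e eq by (auto simp: l_def)
      obtain z where z: "x < z" "z < R" "F z < F x + e"
        using cINF_less_iff[OF nL bL, of "F x + e"] e eq by (auto simp: L_def)
      have "dist (F w) (F x) < e" if w: "dist w x < min (x - y) (z - x)" for w
      proof -
        have "y \<le> w" "w \<le> z" using w by (auto simp: dist_real_def)
        then have "F y \<le> F w" "F w \<le> F z" using y z by (auto intro: mono)
        then show ?thesis using y z by (auto simp: dist_real_def)
      qed
      then show "\<exists>d>0. \<forall>w. dist w x < d \<longrightarrow> dist (F w) (F x) < e"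
        using y z by (intro exI[of _ "min (x - y) (z - x)"]) auto
    qed
  qed
  then show ?thesis by (simp add: continuous_on_eq_continuous_at)
qed

section \<open>From bounded intervals to the domain\<close>

text \<open>The analysis above is carried out on intervals \<open>(0, R)\<close> with real \<open>R\<close>, so that subtracting the
  averaging length makes sense. Any two points of the domain lie in a common such interval, which is
  all that convexity and monotonicity need.\<close>

lemma ival_exhaust:
  assumes "x \<in> ival \<rho>" "y \<in> ival \<rho>"
  obtains R where "ereal R \<le> \<rho>" "x \<in> {0<..<R}" "y \<in> {0<..<R}"
proof (cases \<rho>)
  case (real r)
  then show ?thesis using assms by (intro that[of r]) (auto simp: ival_def)
next
  case PInf
  then show ?thesis using assms by (intro that[of "max x y + 1"]) (auto simp: ival_def)
qed (use assms in \<open>auto simp: ival_def\<close>)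

lemma interval_subset_ival: "ereal R \<le> \<rho> \<Longrightarrow> {0<..<R} \<subseteq> ival \<rho>"
  by (auto simp: ival_def intro: less_le_trans[of _ "ereal R"])

lemma open_ival: "open (ival \<rho>)"
proof (subst open_subopen, intro ballI)
  fix x assume "x \<in> ival \<rho>"
  then obtain R where "ereal R \<le> \<rho>" "x \<in> {0<..<R}" using ival_exhaust by blast
  then show "\<exists>T. open T \<and> x \<in> T \<and> T \<subseteq> ival \<rho>"
    using interval_subset_ival[of R \<rho>] by (intro exI[of _ "{0<..<R}"]) auto
qed

lemma monotone_to_order_ival:
  assumes "\<And>R. ereal R \<le> \<rho> \<Longrightarrow> monotone_to_order m f {0<..<R}"
  shows "monotone_to_order m f (ival \<rho>)"
  unfolding monotone_to_order_def
proof (intro conjI)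
  let ?g = "nth_deriv m f"
  have *: "\<exists>R. monotone_to_order m f {0<..<R} \<and> {0<..<R} \<subseteq> ival \<rho> \<and> x \<in> {0<..<R} \<and> y \<in> {0<..<R}"
    if xy: "x \<in> ival \<rho>" "y \<in> ival \<rho>" for x y
  proof -
    obtain R where R: "ereal R \<le> \<rho>" "x \<in> {0<..<R}" "y \<in> {0<..<R}"
      using ival_exhaust[OF xy] by blast
    then show ?thesis using assms[OF R(1)] interval_subset_ival[OF R(1)] by blast
  qed
  have diff: "nth_deriv k f field_differentiable at x" if "x \<in> ival \<rho>" "k < m" for k x
    using *[OF that(1) that(1)] that(2) unfolding monotone_to_order_def Ck_on_def by blast
  have cont: "isCont ?g x" if x: "x \<in> ival \<rho>" for x
  proof -
    obtain R where R: "continuous_on {0<..<R} ?g" "x \<in> {0<..<R}"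
      using *[OF x x] unfolding monotone_to_order_def Ck_on_def by blast
    then show ?thesis
      unfolding continuous_on_eq_continuous_at[OF open_greaterThanLessThan] by blast
  qed
  show "Ck_on m f (ival \<rho>)"
    unfolding Ck_on_def continuous_on_eq_continuous_at[OF open_ival] using diff cont by blast
  show "\<forall>k\<le>m. \<forall>x\<in>ival \<rho>. 0 \<le> nth_deriv k f x"
  proof (intro allI impI ballI)
    fix k x assume "k \<le> m" and x: "x \<in> ival \<rho>"
    then show "0 \<le> nth_deriv k f x"
      using *[OF x x] unfolding monotone_to_order_def by blast
  qed
  show "mono_on (ival \<rho>) ?g"
  proof (rule mono_onI)
    fix x y assume x: "x \<in> ival \<rho>" "y \<in> ival \<rho>" and "x \<le> y"
    then show "?g x \<le> ?g y"
      using *[OF x] unfolding monotone_to_order_def by (blast dest: mono_onD)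
  qed
  show "convex_on (ival \<rho>) ?g"
  proof (rule convex_onI)
    fix t x y :: real assume t: "0 < t" "t < 1" and x: "x \<in> ival \<rho>" "y \<in> ival \<rho>"
    obtain R where R: "convex_on {0<..<R} ?g" "x \<in> {0<..<R}" "y \<in> {0<..<R}"
      using *[OF x] unfolding monotone_to_order_def by blast
    show "?g ((1 - t) *\<^sub>R x + t *\<^sub>R y) \<le> (1 - t) * ?g x + t * ?g y"
      using convex_onD[OF R(1) _ _ R(2,3), of t] t by simp
  next
    show "convex (ival \<rho>)"
      unfolding convex_alt
    proof (intro ballI allI impI)
      fix x y u :: real assume x: "x \<in> ival \<rho>" "y \<in> ival \<rho>" and u: "0 \<le> u \<and> u \<le> 1"
      obtain R where R: "{0<..<R} \<subseteq> ival \<rho>" "x \<in> {0<..<R}" "y \<in> {0<..<R}"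
        using *[OF x] by blast
      have "(1 - u) *\<^sub>R x + u *\<^sub>R y \<in> {0<..<R}"
        using u by (intro convexD_alt[OF convex_real_interval(8) R(2,3)]) auto
      then show "(1 - u) *\<^sub>R x + u *\<^sub>R y \<in> ival \<rho>" using R(1) by blast
    qed
  qed
qed

lemma hankel_family_psd_imp_hankel_psd:
  assumes psd: "\<forall>A\<in>hankel_family \<rho> u N. map_mat F A \<in> psd_mats N UNIV" and R: "ereal R \<le> \<rho>"
  shows "hankel_psd N u R F"
  unfolding hankel_psd_def
proof (intro allI impI)
  fix v :: "nat \<Rightarrow> real" and a b :: real
  assume ab: "0 < a \<and> 0 < b \<and> a + b < R"
  define A where "A = a \<cdot>\<^sub>m ones_mat N + b \<cdot>\<^sub>m outer_mat (geom_vec N u)"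
  have "ereal a < \<rho>" "ereal b < \<rho> - ereal a" "ereal (a + b) < \<rho>"
    using ab R by (cases \<rho>; simp)+
  then have "A \<in> hankel_family \<rho> u N"
    unfolding A_def hankel_family_def mem_Collect_eq using ab
    by (intro exI[of _ a] exI[of _ b] conjI refl) auto
  with psd have FA: "map_mat F A \<in> psd_mats N UNIV" by blast
  have dim: "dim_row A = N" "dim_col A = N"
    by (auto simp: A_def ones_mat_def outer_mat_def geom_vec_def)
  have entry: "A $$ (p, q) = a + b * u ^ (p + q)" if "p < N" "q < N" for p q
    unfolding A_def using that by (rule hankel_entry)
  let ?v = "Matrix.vec N v"
  have "0 \<le> ?v \<bullet> (map_mat F A *\<^sub>v ?v)" using FA by (simp add: psd_mats_def)
  also have "\<dots> = (\<Sum>p<N. v p * (\<Sum>q<N. F (A $$ (p, q)) * v q))"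
    by (simp add: scalar_prod_def atLeast0LessThan dim)
  also have "\<dots> = (\<Sum>p<N. \<Sum>q<N. v p * v q * F (a + b * u ^ (p + q)))"
    unfolding sum_distrib_left by (intro sum.cong refl) (simp add: entry mult_ac)
  finally show "0 \<le> (\<Sum>p<N. \<Sum>q<N. v p * v q * F (a + b * u ^ (p + q)))" .
qed

theorem theorem4p2:
  fixes F :: "real \<Rightarrow> real" and \<rho> :: ereal and u0 :: real and N :: nat and I :: "real set"
  assumes "0 < \<rho>"
    and "I = ival \<rho>"
    and "0 < u0" and "u0 < 1"
    and "3 \<le> N"
    and "\<forall>A \<in> hankel_family \<rho> u0 N. map_mat F A \<in> psd_mats N UNIV"
  shows "((\<forall>A \<in> psd_mats 2 I. map_mat F A \<in> psd_mats 2 UNIV) \<longrightarrow>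
            (Ck_on (N - 3) F I \<and>
             (\<forall>k \<le> N - 3. \<forall>x \<in> I. 0 \<le> nth_deriv k F x) \<and>
             convex_on I (nth_deriv (N - 3) F) \<and>
             mono_on I (nth_deriv (N - 3) F)) \<and>
            (Ck_on (N - 1) F I \<longrightarrow> (\<forall>k \<le> N - 1. \<forall>x \<in> I. 0 \<le> nth_deriv k F x)))
       \<and> (continuous_on I F \<longrightarrow>
            (Ck_on (N - 3) F I \<and>
             (\<forall>k \<le> N - 3. \<forall>x \<in> I. 0 \<le> nth_deriv k F x) \<and>
             convex_on I (nth_deriv (N - 3) F) \<and>
             mono_on I (nth_deriv (N - 3) F)) \<and>
            (Ck_on (N - 1) F I \<longrightarrow> (\<forall>k \<le> N - 1. \<forall>x \<in> I. 0 \<le> nth_deriv k F x)))"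
proof -
  note I = \<open>I = ival \<rho>\<close> and u = \<open>0 < u0\<close> \<open>u0 < 1\<close>
  have psd: "hankel_psd N u0 R F" if "ereal R \<le> \<rho>" for R
    using assms(6) that by (rule hankel_family_psd_imp_hankel_psd)
  have continuous_case: "monotone_to_order (N - 3) F I" if "continuous_on I F"
    unfolding I
  proof (rule monotone_to_order_ival)
    fix R assume R: "ereal R \<le> \<rho>"
    show "monotone_to_order (N - 3) F {0<..<R}"
      using continuous_hankel_psd_imp_monotone[OF u, of R F "N - 3"] psd[OF R] \<open>3 \<le> N\<close>
        continuous_on_subset[OF that] interval_subset_ival[OF R] I by auto
  qed
  have smooth_case: "Ck_on (N - 1) F I \<longrightarrow> (\<forall>k \<le> N - 1. \<forall>x \<in> I. 0 \<le> nth_deriv k F x)"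
  proof (intro impI allI ballI)
    fix k x assume C: "Ck_on (N - 1) F I" and k: "k \<le> N - 1" and x: "x \<in> I"
    obtain R where R: "ereal R \<le> \<rho>" "x \<in> {0<..<R}" using ival_exhaust x I by metis
    have "Ck_on (N - 1) F {0<..<R}"
      using C interval_subset_ival[OF R(1)] unfolding I Ck_on_def
      by (auto intro: continuous_on_subset)
    then show "0 \<le> nth_deriv k F x"
      using Ck_hankel_psd_imp_nonneg[OF u psd[OF R(1)]] k R \<open>3 \<le> N\<close> by auto
  qed
  have "continuous_on I F" if pres: "\<forall>A \<in> psd_mats 2 I. map_mat F A \<in> psd_mats 2 UNIV"
  proof -
    have cont: "continuous_on {0<..<R} F" if R: "ereal R \<le> \<rho>" for R
    proof (rule continuous_on_if_psd2_ineq)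
      have sub: "x \<in> I" if "0 < x" "x < R" for x
        using that interval_subset_ival[OF R] I by auto
      show "0 \<le> F a" if "0 < a" "a < R" for a
        using psd2_preserver_ineq(1)[OF pres, of a a a] sub[OF that] that by (simp add: power2_eq_square)
      show "(F b)\<^sup>2 \<le> F a * F c"
        if "0 < a" "a < R" "0 < b" "b < R" "0 < c" "c < R" "b\<^sup>2 \<le> a * c" for a b c
        using that by (intro psd2_preserver_ineq(2)[OF pres] sub) auto
    qed
    have "isCont F x" if x: "x \<in> I" for x
    proof -
      obtain R where "ereal R \<le> \<rho>" "x \<in> {0<..<R}" using ival_exhaust x I by metis
      then show ?thesis using cont[of R] by (simp add: continuous_on_eq_continuous_at)
    qed
    then show ?thesis unfolding I by (simp add: continuous_on_eq_continuous_at open_ival)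
  qed
  with continuous_case smooth_case show ?thesis
    unfolding monotone_to_order_def[symmetric] by blast
qed

end
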